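(* Let $d, m \geq 1$ be integers, let $\lambda = (\lambda_1, \dots, \lambda_m)$ be a weight, let $-\infty < p \leq 1/d$, let $\gamma_1, \dots, \gamma_m > 0$, and put $\gamma = M_p^\lambda(\gamma_1, \dots, \gamma_m)$. Let $\kappa_1, \dots, \kappa_m > 0$, $\omega \geq 0$, $\theta = (\theta_1, \dots, \theta_m) \in (\mathbb{R}^d)^m$, and let $\psi \colon \mathbb{R}^d \to \mathbb{R}_{\geq 0}$ be an integrable $(-p)$-concave function with $0 < \| \psi \|_1 < \infty$. For $i = 1, \dots, m$ define $$f_i(x) = \kappa_i \, \psi\left( \frac{x - \theta_i}{\gamma_i^p} \right), \qquad g_i(x) = \omega \kappa_i \gamma_i \, \psi\left( \frac{x - z_\lambda(\theta)}{\gamma^p} \right) \qquad (x \in \mathbb{R}^d).$$ Put $S = S(f_1) \times \dots \times S(f_m)$ and $$K = \operatorname*{ess\,inf}_{x = (x_1, \dots, x_m) \in S} M_p^\lambda \left( \frac{g_1(z_\lambda(x))}{f_1(x_1)}, \dots, \frac{g_m(z_\lambda(x))}{f_m(x_m)} \right),$$ the essential infimum being with respect to Lebesgue measure on $S$. Then $$K = M_{Q_d(p)}^\lambda \left( \frac{\| g_1 \|_1}{\| f_1 \|_1}, \dots, \frac{\| g_m \|_1}{\| f_m \|_1} \right) = \omega \gamma.$$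
   Context: A weight is a tuple $\lambda = (\lambda_1, \dots, \lambda_m)$ of positive real numbers with $\sum_{i=1}^m \lambda_i = 1$. For a weight $\lambda$ and $-\infty \leq p \leq \infty$, the weighted power mean $M_p^\lambda \colon \mathbb{R}_{\geq 0}^m \to \mathbb{R}_{\geq 0}$ is defined by: $M_0^\lambda(a) = \prod_{i=1}^m a_i^{\lambda_i}$; $M_{-\infty}^\lambda(a) = \min_i a_i$; $M_\infty^\lambda(a) = \max_i a_i$; $M_p^\lambda(a) = 0$ if $-\infty \leq p \leq 0$ and $\prod_{i=1}^m a_i = 0$; and $M_p^\lambda(a) = \left( \sum_{i=1}^m \lambda_i a_i^p \right)^{1/p}$ otherwise. For a tuple $\lambda$ of positive reals and $x = (x_1, \dots, x_m) \in (\mathbb{R}^d)^m$, $z_\lambda(x) = \sum_{i=1}^m \lambda_i x_i \in \mathbb{R}^d$. For $f \colon \mathbb{R}^d \to \mathbb{R}_{\geq 0}$, $S(f) = \{ x \in \mathbb{R}^d \mid f(x) > 0 \}$, and $\| f \|_1$ is the $L^1$ norm with respect to Lebesgue measure. The power transform $Q_d \colon [-\infty, 1/d] \to [-\infty, \infty]$ is $Q_d(p) = \frac{p}{1 - dp}$ for $-\infty < p < 1/d$, $Q_d(-\infty) = -1/d$, and $Q_d(1/d) = \infty$. For $-\infty \leq \alpha \leq \infty$, a function $\psi \colon \mathbb{R}^d \to \mathbb{R}_{\geq 0}$ is called $\alpha$-concave if $M_\alpha^{\lambda^*}(\psi(x_1^* ), \dots, \psi(x_m^* )) \leq \psi(z_{\lambda^*}(x^*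 ))$ for every weight $\lambda^* = (\lambda_1^*, \dots, \lambda_m^* )$ and every $x^* = (x_1^*, \dots, x_m^* ) \in S(\psi)^m$ (with $m$ the given number of functions). *)

theory Defs
  imports "HOL-Analysis.Analysis"
begin

text \<open>Tuples of length \<open>m\<close> are indexed by a finite type \<open>'m\<close> with \<open>m = CARD('m)\<close>: tuples of numbers are
  functions on \<open>'m\<close>, while tuples of points, on which Lebesgue measure is needed, are vectors of
  type \<open>'a ^ 'm\<close>.\<close>

definition weight :: "('m::finite \<Rightarrow> real) \<Rightarrow> bool" where
  "weight lam \<longleftrightarrow> (\<forall>i. 0 < lam i) \<and> (\<Sum>i\<in>UNIV. lam i) = 1"

text \<open>Meant for entries \<open>a i \<ge> 0\<close>. Since \<open>0 powr r = 0\<close> for every \<open>r\<close>, the clause for a vanishing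
  product is what gives the right value for \<open>p < 0\<close>.\<close>

definition power_mean :: "ereal \<Rightarrow> ('m::finite \<Rightarrow> real) \<Rightarrow> ('m \<Rightarrow> real) \<Rightarrow> real" where
  "power_mean p lam a =
    (if p = 0 then (\<Prod>i\<in>UNIV. a i powr lam i)
     else if p = - \<infinity> then Min (range a)
     else if p = \<infinity> then Max (range a)
     else if p \<le> 0 \<and> (\<Prod>i\<in>UNIV. a i) = 0 then 0
     else (\<Sum>i\<in>UNIV. lam i * a i powr real_of_ereal p) powr (1 / real_of_ereal p))"

definition weighted_sum :: "('m::finite \<Rightarrow> real) \<Rightarrow> 'a::real_vector ^ 'm \<Rightarrow> 'a" where
  "weighted_sum lam x = (\<Sum>i\<in>UNIV. lam i *\<^sub>R (x $ i))"

definition pos_set :: "('a \<Rightarrow> real) \<Rightarrow> 'a set" where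
  "pos_set f = {x. 0 < f x}"

text \<open>Only meaningful for Lebesgue integrable \<open>f\<close>; otherwise the Bochner integral is \<open>0\<close>.\<close>

definition L1_norm :: "('a::euclidean_space \<Rightarrow> real) \<Rightarrow> real" where
  "L1_norm f = (\<integral>x. \<bar>f x\<bar> \<partial>lebesgue)"

text \<open>Intended domain: \<open>d \<ge> 1\<close> and \<open>p \<le> 1 / d\<close>.\<close>

definition power_transform :: "nat \<Rightarrow> ereal \<Rightarrow> ereal" where
  "power_transform d p =
    (if p = - \<infinity> then ereal (- (1 / real d))
     else if p = ereal (1 / real d) then \<infinity>
     else ereal (real_of_ereal p / (1 - real d * real_of_ereal p)))"

text \<open>Concavity is tested on tuples of the given length \<open>m\<close> only (so for \<open>m = 1\<close> it is no
  restriction); the type argument supplies \<open>m\<close>.\<close>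

definition alpha_concave ::
    "'m::finite itself \<Rightarrow> ereal \<Rightarrow> ('a::real_vector \<Rightarrow> real) \<Rightarrow> bool" where
  "alpha_concave _ \<alpha> \<psi> \<longleftrightarrow>
    (\<forall>(lam :: 'm \<Rightarrow> real) (x :: 'a ^ 'm).
       weight lam \<longrightarrow> (\<forall>i. x $ i \<in> pos_set \<psi>) \<longrightarrow>
       power_mean \<alpha> lam (\<lambda>i. \<psi> (x $ i)) \<le> \<psi> (weighted_sum lam x))"

text \<open>The largest almost-everywhere lower bound, taken in the extended reals so that the supremum
  always exists.\<close>

definition ess_inf :: "'a measure \<Rightarrow> ('a \<Rightarrow> ereal) \<Rightarrow> ereal" where
  "ess_inf M f = Sup {c. AE x in M. c \<le> f x}"

end

theory Submission
  imports Defs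
begin

text \<open>In the coordinates \<open>y\<^sub>i = (x\<^sub>i - \<theta>\<^sub>i) / \<gamma>\<^sub>i\<^sup>p\<close> and with the tilted weight
  \<open>\<mu>\<^sub>i = \<lambda>\<^sub>i \<gamma>\<^sub>i\<^sup>p / \<gamma>\<^sup>p\<close>, the function inside the essential infimum is \<open>\<omega> \<gamma>\<close> times the ratio of
  \<open>\<psi> (\<Sum>\<mu>\<^sub>i y\<^sub>i)\<close> to the \<open>\<mu>\<close>-weighted mean of exponent \<open>- p\<close> of the \<open>\<psi> y\<^sub>i\<close>. Concavity says that this
  ratio is at least \<open>1\<close>, and it equals \<open>1\<close> on the diagonal. For \<open>m \<ge> 2\<close> the function \<open>\<psi>\<close> is continuous
  in the interior of its convex support, so the ratio is close to \<open>1\<close> on an open set around a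
  diagonal point; for \<open>m = 1\<close> it is constant. The value of the mean of the norms is a direct
  computation from the scaling of the Lebesgue integral.\<close>

section \<open>Weights and weighted power means\<close>

lemma weight_pos: "weight lam \<Longrightarrow> 0 < lam i"
  by (simp add: weight_def)

lemma weight_sum: "weight lam \<Longrightarrow> (\<Sum>i\<in>UNIV. lam i) = 1"
  by (simp add: weight_def)

lemma power_mean_nonzero:
  fixes a :: "'m::finite \<Rightarrow> real"
  assumes "p \<noteq> 0" and "\<And>i. 0 < a i"
  shows "power_mean (ereal p) lam a = (\<Sum>i\<in>UNIV. lam i * a i powr p) powr (1 / p)"
proof -
  have "a i \<noteq> 0" for i
    using assms(2)[of i] by simp
  then show ?thesis
    using assms(1) by (simp add: power_mean_def)
qed

lemma power_mean_0: "power_mean (ereal 0) lam a = (\<Prod>i\<in>UNIV. a i powr lam i)"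
  by (simp add: power_mean_def zero_ereal_def[symmetric])

lemma weighted_powr_sum_pos:
  fixes a :: "'m::finite \<Rightarrow> real"
  assumes "weight lam" and "\<And>i. 0 < a i"
  shows "0 < (\<Sum>i\<in>UNIV. lam i * a i powr p)"
proof (rule sum_pos)
  show "0 < lam i * a i powr p" for i
    using weight_pos[OF assms(1), of i] assms(2)[of i] by simp
qed auto

lemma power_mean_pos:
  fixes a :: "'m::finite \<Rightarrow> real"
  assumes "weight lam" and "\<And>i. 0 < a i"
  shows "0 < power_mean (ereal p) lam a"
proof (cases "p = 0")
  case True
  have "a i \<noteq> 0" for i
    using assms(2)[of i] by simp
  then show ?thesis
    by (simp add: True power_mean_0 prod_pos)
next
  case False
  then show ?thesis
    using weighted_powr_sum_pos[OF assms(1), of a p] assms(2) by (simp add: power_mean_nonzero)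
qed

lemma power_mean_null:
  assumes "weight lam"
  shows "power_mean (ereal p) lam (\<lambda>i. 0) = 0"
  by (cases "p = 0") (simp_all add: power_mean_def)

lemma power_mean_scale:
  fixes a :: "'m::finite \<Rightarrow> real"
  assumes w: "weight lam" and c: "0 \<le> c" and a: "\<And>i. 0 < a i"
  shows "power_mean (ereal p) lam (\<lambda>i. c * a i) = c * power_mean (ereal p) lam a"
proof -
  consider "c = 0" | "0 < c" "p = 0" | "0 < c" "p \<noteq> 0"
    using c by linarith
  then show ?thesis
  proof cases
    case 1
    then show ?thesis using w by (simp add: power_mean_null)
  next
    case 2
    have "(\<Prod>i\<in>UNIV. c powr lam i) = c powr (\<Sum>i\<in>UNIV. lam i)"
      using 2 by (subst powr_sum) auto
    then show ?thesis
      using 2 a less_imp_le[OF a] by (simp add: power_mean_0 powr_mult prod.distrib weight_sum[OF w])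
  next
    case 3
    let ?A = "\<Sum>i\<in>UNIV. lam i * a i powr p"
    have "(\<Sum>i\<in>UNIV. lam i * (c * a i) powr p) = c powr p * ?A"
      using 3 less_imp_le[OF a] by (simp add: powr_mult sum_distrib_left ac_simps)
    moreover have "(c powr p * ?A) powr (1 / p) = c * ?A powr (1 / p)"
      using 3 weighted_powr_sum_pos[OF w, of a p] a by (simp add: powr_mult powr_powr)
    ultimately show ?thesis
      using 3 a by (simp add: power_mean_nonzero)
  qed
qed

lemma power_mean_const:
  assumes "weight lam" and "0 \<le> c"
  shows "power_mean (ereal p) lam (\<lambda>i. c) = c"
proof -
  have "power_mean (ereal p) lam (\<lambda>i. 1) = 1"
    by (cases "p = 0") (simp_all add: power_mean_0 power_mean_nonzero weight_sum[OF assms(1)])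
  then show ?thesis
    using power_mean_scale[OF assms, of "\<lambda>i. 1" p] by simp
qed

section \<open>Tilted weights, quotients and the power transform\<close>

definition tilted_weight :: "real \<Rightarrow> ('m::finite \<Rightarrow> real) \<Rightarrow> ('m \<Rightarrow> real) \<Rightarrow> 'm \<Rightarrow> real" where
  "tilted_weight p lam \<gamma> i = lam i * \<gamma> i powr p / power_mean (ereal p) lam \<gamma> powr p"

text \<open>Raising to the power p cancels the outer exponent 1/p; at p = 0 both sides are 1. This
  is the normalisation that makes the tilted weights sum to 1.\<close>

lemma power_mean_powr:
  fixes a :: "'m::finite \<Rightarrow> real"
  assumes "weight lam" and "\<And>i. 0 < a i"
  shows "power_mean (ereal p) lam a powr p = (\<Sum>i\<in>UNIV. lam i * a i powr p)"
proof (cases "p = 0")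
  case True
  have "a i \<noteq> 0" for i
    using assms(2)[of i] by simp
  with True show ?thesis
    using power_mean_pos[OF assms(1), of a 0] assms(2) by (simp add: weight_sum[OF assms(1)])
next
  case False
  then show ?thesis
    using weighted_powr_sum_pos[OF assms(1), of a p] assms(2) by (simp add: power_mean_nonzero powr_powr)
qed

lemma weight_tilted_weight:
  assumes w: "weight lam" and \<gamma>: "\<And>i. 0 < \<gamma> i"
  shows "weight (tilted_weight p lam \<gamma>)"
proof -
  have pos: "0 < power_mean (ereal p) lam \<gamma>"
    by (rule power_mean_pos[OF assms])
  have "(\<Sum>i\<in>UNIV. tilted_weight p lam \<gamma> i)
      = (\<Sum>i\<in>UNIV. lam i * \<gamma> i powr p) / power_mean (ereal p) lam \<gamma> powr p"
    by (simp add: tilted_weight_def sum_divide_distrib)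
  moreover have "0 < tilted_weight p lam \<gamma> i" for i
    using pos weight_pos[OF w, of i] \<gamma>[of i] by (simp add: tilted_weight_def)
  ultimately show ?thesis
    using weighted_powr_sum_pos[OF w, of \<gamma> p] \<gamma> by (simp add: weight_def power_mean_powr[OF assms])
qed

text \<open>Since lam_i \<gamma>_i^p is the tilted weight times M^p, where M is the mean of the
  \<gamma>_i, the inner sum equals M^p times the tilted sum of the b_i^(-p). Reading the outer
  exponent 1/p as -1/(-p) moves that mean into the denominator, which is how the exponent -p of the
  concavity hypothesis arises. At p = 0 the tilted weight is \<open>lam\<close> itself.\<close>

lemma power_mean_divide:
  fixes b :: "'m::finite \<Rightarrow> real"
  assumes w: "weight lam" and \<gamma>: "\<And>i. 0 < \<gamma> i" and b: "\<And>i. 0 < b i"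
  shows "power_mean (ereal p) lam (\<lambda>i. \<gamma> i / b i)
    = power_mean (ereal p) lam \<gamma> / power_mean (ereal (- p)) (tilted_weight p lam \<gamma>) b"
proof (cases "p = 0")
  case True
  have [simp]: "\<gamma> i \<noteq> 0" for i using \<gamma>[of i] by simp
  have "power_mean (ereal 0) lam \<gamma> \<noteq> 0"
    using power_mean_pos[OF w, of \<gamma> 0] \<gamma> by simp
  then show ?thesis
    using less_imp_le[OF \<gamma>] less_imp_le[OF b]
    by (simp add: True power_mean_0 tilted_weight_def powr_divide prod_dividef)
next
  case False
  let ?M = "power_mean (ereal p) lam \<gamma>" and ?A = "\<Sum>i\<in>UNIV. lam i * (\<gamma> i / b i) powr p"
  have M: "0 < ?M" by (rule power_mean_pos[OF w \<gamma>])
  have A: "0 < ?A" using \<gamma> b by (intro weighted_powr_sum_pos[OF w]) simp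
  have "(\<Sum>i\<in>UNIV. tilted_weight p lam \<gamma> i * b i powr - p) = ?A / ?M powr p"
    using less_imp_le[OF \<gamma>] less_imp_le[OF b]
    by (simp add: tilted_weight_def sum_divide_distrib powr_minus_divide powr_divide mult.commute)
  moreover have "(?A / ?M powr p) powr (1 / - p) = ?M / ?A powr (1 / p)"
    using False M A by (simp add: powr_divide powr_powr powr_minus_divide)
  ultimately have "power_mean (ereal (- p)) (tilted_weight p lam \<gamma>) b = ?M / ?A powr (1 / p)"
    using power_mean_nonzero[of "- p" b "tilted_weight p lam \<gamma>"] False b by simp
  moreover have "power_mean (ereal p) lam (\<lambda>i. \<gamma> i / b i) = ?A powr (1 / p)"
    using False \<gamma> b by (simp add: power_mean_nonzero)
  ultimately show ?thesis
    using M by simp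
qed

text \<open>With q = p / (1 - d p), raising \<gamma>_i^(1 - d p) to the power q gives \<gamma>_i^p,
  and 1/q = (1 - d p) / p restores the outer exponent. At the endpoint p = 1/d the exponent 1 - d p
  is 0, so the tuple is constantly c and so is its maximum.\<close>

lemma power_mean_power_transform:
  fixes \<gamma> :: "'m::finite \<Rightarrow> real"
  assumes w: "weight lam" and \<gamma>: "\<And>i. 0 < \<gamma> i" and d: "0 < d" and p: "p \<le> 1 / real d" and c: "0 \<le> c"
  shows "power_mean (power_transform d (ereal p)) lam (\<lambda>i. c * \<gamma> i powr (1 - real d * p))
    = c * power_mean (ereal p) lam \<gamma> powr (1 - real d * p)"
proof -
  have M: "0 < power_mean (ereal p) lam \<gamma>"
    by (rule power_mean_pos[OF w \<gamma>])
  have [simp]: "\<gamma> i \<noteq> 0" for i using \<gamma>[of i] by simp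
  consider "p = 1 / real d" | "p = 0" | "p < 1 / real d" "p \<noteq> 0"
    using p by linarith
  then show ?thesis
  proof cases
    case 1
    then have "power_transform d (ereal p) = \<infinity>"
      by (simp add: power_transform_def)
    then show ?thesis
      using 1 M d by (simp add: power_mean_def)
  next
    case 2
    then have "power_transform d (ereal p) = ereal 0"
      using d by (simp add: power_transform_def)
    then show ?thesis
      using 2 M \<gamma> less_imp_le[OF \<gamma>] by (simp add: power_mean_scale[OF w c])
  next
    case 3
    define q where "q = p / (1 - real d * p)"
    have dp: "0 < 1 - real d * p"
      using 3 d by (simp add: field_simps)
    have q: "q \<noteq> 0" "(1 - real d * p) * q = p" "(1 - real d * p) / p = 1 / q"
      using 3 dp by (auto simp: q_def)
    have "power_transform d (ereal p) = ereal q"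
      using 3 by (simp add: power_transform_def q_def)
    moreover have "power_mean (ereal q) lam (\<lambda>i. \<gamma> i powr (1 - real d * p))
        = power_mean (ereal p) lam \<gamma> powr (1 - real d * p)"
      using 3 q \<gamma> by (simp add: power_mean_nonzero powr_powr)
    ultimately show ?thesis
      by (simp add: power_mean_scale[OF w c])
  qed
qed

section \<open>Linearising power means\<close>

text \<open>The strictly increasing transform that turns the power mean of exponent \<open>q\<close> into an arithmetic mean,
  normalised by \<open>1 / q\<close> so that it increases also for \<open>q < 0\<close>; it converts \<open>q\<close>-concavity into
  ordinary concavity.\<close>

definition power_scale :: "real \<Rightarrow> real \<Rightarrow> real" where
  "power_scale q s = (if q = 0 then ln s else s powr q / q)"

lemma power_scale_mono:
  assumes "0 < s" and "s \<le> t"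
  shows "power_scale q s \<le> power_scale q t"
proof -
  consider "q = 0" | "0 < q" | "q < 0" by linarith
  then show ?thesis
  proof cases
    case 2
    then show ?thesis
      using assms by (simp add: power_scale_def powr_mono2 divide_right_mono)
  next
    case 3
    then have "t powr q \<le> s powr q"
      using assms by (intro powr_mono2') auto
    then show ?thesis
      using 3 by (simp add: power_scale_def divide_right_mono_neg)
  qed (use assms in \<open>simp add: power_scale_def\<close>)
qed

lemma power_scale_power_mean:
  fixes a :: "'m::finite \<Rightarrow> real"
  assumes "weight lam" and "\<And>i. 0 < a i"
  shows "power_scale q (power_mean (ereal q) lam a) = (\<Sum>i\<in>UNIV. lam i * power_scale q (a i))"
proof (cases "q = 0")
  case True
  have "a i \<noteq> 0" for i
    using assms(2)[of i] by simp
  with True assms(2) show ?thesis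
    by (simp add: power_scale_def power_mean_0 ln_prod)
next
  case False
  then show ?thesis
    using assms by (simp add: power_scale_def power_mean_powr sum_divide_distrib)
qed

text \<open>Limits pass back through the inverse of the transform, \<open>exp\<close> for q = 0 and
  s to (q s)^(1/q) otherwise, which is continuous at the limit value. Positivity of f ensures that
  the inverse recovers f x.\<close>

lemma tendsto_of_power_scale:
  assumes "((\<lambda>x. power_scale q (f x)) \<longlongrightarrow> power_scale q l) F"
    and "eventually (\<lambda>x. 0 < f x) F" and "0 < l"
  shows "(f \<longlongrightarrow> l) F"
proof (cases "q = 0")
  case True
  have "((\<lambda>x. exp (power_scale q (f x))) \<longlongrightarrow> exp (power_scale q l)) F"
    by (intro tendsto_intros assms(1))
  moreover have "eventually (\<lambda>x. exp (power_scale q (f x)) = f x) F"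
    using assms(2) by eventually_elim (simp add: True power_scale_def)
  ultimately have "(f \<longlongrightarrow> exp (power_scale q l)) F"
    by (rule Lim_transform_eventually)
  then show ?thesis
    using True assms(3) by (simp add: power_scale_def)
next
  case False
  have "((\<lambda>x. (q * power_scale q (f x)) powr (1 / q)) \<longlongrightarrow> (q * power_scale q l) powr (1 / q)) F"
    using False assms(3) by (intro tendsto_intros assms(1)) (simp add: power_scale_def)
  moreover have "eventually (\<lambda>x. (q * power_scale q (f x)) powr (1 / q) = f x) F"
    using assms(2) by eventually_elim (simp add: False power_scale_def powr_powr)
  ultimately have "(f \<longlongrightarrow> (q * power_scale q l) powr (1 / q)) F"
    by (rule Lim_transform_eventually)
  then show ?thesis
    using False assms(3) by (simp add: power_scale_def powr_powr)
qed

section \<open>Convex support and continuity of alpha-concave functions\<close>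

text \<open>Embeds a convex combination of two points into a tuple of length m: one index carries x
  with weight 1 - t, and the other m - 1 indices carry y and share t equally, so that every weight
  stays positive for 0 < t < 1.\<close>

lemma sum_two_valued:
  fixes h :: "'b \<Rightarrow> 'a::real_vector" and i\<^sub>0 :: "'m::finite"
  assumes "1 < CARD('m)"
  shows "(\<Sum>i\<in>UNIV. (if i = i\<^sub>0 then 1 - t else t / (real CARD('m) - 1)) *\<^sub>R h (if i = i\<^sub>0 then x else y))
    = (1 - t) *\<^sub>R h x + t *\<^sub>R h y"
proof -
  have "(\<Sum>i\<in>UNIV - {i\<^sub>0}. (if i = i\<^sub>0 then 1 - t else t / (real CARD('m) - 1)) *\<^sub>R h (if i = i\<^sub>0 then x else y))
      = (\<Sum>i\<in>UNIV - {i\<^sub>0}. (t / (real CARD('m) - 1)) *\<^sub>R h y)"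
    by (intro sum.cong) auto
  also have "\<dots> = t *\<^sub>R h y"
    using assms by (simp add: sum_constant_scaleR)
  finally show ?thesis
    by (subst sum.remove[of _ i\<^sub>0]) simp_all
qed

lemma alpha_concave_weighted_sum:
  fixes \<psi> :: "'a::real_vector \<Rightarrow> real" and x :: "'a ^ 'm::finite"
  assumes "alpha_concave TYPE('m) (ereal q) \<psi>" and "weight lam" and "\<And>i. x $ i \<in> pos_set \<psi>"
  shows "0 < power_mean (ereal q) lam (\<lambda>i. \<psi> (x $ i))"
    and "power_mean (ereal q) lam (\<lambda>i. \<psi> (x $ i)) \<le> \<psi> (weighted_sum lam x)"
proof -
  show "0 < power_mean (ereal q) lam (\<lambda>i. \<psi> (x $ i))"
    using assms(3) by (intro power_mean_pos[OF assms(2)]) (simp add: pos_set_def)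
  show "power_mean (ereal q) lam (\<lambda>i. \<psi> (x $ i)) \<le> \<psi> (weighted_sum lam x)"
    using assms by (auto simp: alpha_concave_def)
qed

text \<open>Concavity is given only on tuples of the fixed length m, so the binary inequality is
  read off from a two-valued tuple; this takes at least two indices.\<close>

lemma alpha_concave_two_points:
  fixes \<psi> :: "'a::real_vector \<Rightarrow> real"
  assumes m: "1 < CARD('m::finite)" and \<psi>: "alpha_concave TYPE('m) (ereal q) \<psi>"
    and t: "0 < t" "t < 1" and xy: "x \<in> pos_set \<psi>" "y \<in> pos_set \<psi>"
  shows "(1 - t) *\<^sub>R x + t *\<^sub>R y \<in> pos_set \<psi>"
    and "(1 - t) * power_scale q (\<psi> x) + t * power_scale q (\<psi> y)
      \<le> power_scale q (\<psi> ((1 - t) *\<^sub>R x + t *\<^sub>R y))"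
proof -
  obtain i\<^sub>0 :: 'm where True by simp
  define lam where "lam i = (if i = i\<^sub>0 then 1 - t else t / (real CARD('m) - 1))" for i
  define z :: "'a ^ 'm" where "z = (\<chi> i. if i = i\<^sub>0 then x else y)"
  \<comment> \<open>One identity for arbitrary h serves three times: a constant h gives the total
    weight, the identity gives the weighted point, and the transformed \<psi> gives the transformed
    mean.\<close>
  have sum: "(\<Sum>i\<in>UNIV. lam i *\<^sub>R h (z $ i)) = (1 - t) *\<^sub>R h x + t *\<^sub>R h y"
    for h :: "'a \<Rightarrow> 'b::real_vector"
    unfolding lam_def z_def using sum_two_valued[OF m] by simp
  have w: "weight lam"
    using m t sum[of "\<lambda>_. 1 :: real"] by (simp add: weight_def lam_def)
  have z: "z $ i \<in> pos_set \<psi>" for i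
    using xy by (simp add: z_def)
  have ws: "weighted_sum lam z = (1 - t) *\<^sub>R x + t *\<^sub>R y"
    using sum[of "\<lambda>v. v"] by (simp add: weighted_sum_def)
  note * = alpha_concave_weighted_sum[OF \<psi> w z, unfolded ws]
  show "(1 - t) *\<^sub>R x + t *\<^sub>R y \<in> pos_set \<psi>"
    using * by (simp add: pos_set_def)
  have "(1 - t) * power_scale q (\<psi> x) + t * power_scale q (\<psi> y)
      = power_scale q (power_mean (ereal q) lam (\<lambda>i. \<psi> (z $ i)))"
    using z sum[of "\<lambda>v. power_scale q (\<psi> v)"] by (simp add: power_scale_power_mean[OF w] pos_set_def)
  also have "\<dots> \<le> power_scale q (\<psi> ((1 - t) *\<^sub>R x + t *\<^sub>R y))"
    using * by (rule power_scale_mono)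
  finally show "(1 - t) * power_scale q (\<psi> x) + t * power_scale q (\<psi> y)
      \<le> power_scale q (\<psi> ((1 - t) *\<^sub>R x + t *\<^sub>R y))" .
qed

lemma convex_pos_set:
  fixes \<psi> :: "'a::real_vector \<Rightarrow> real"
  assumes "1 < CARD('m::finite)" and "alpha_concave TYPE('m) (ereal q) \<psi>"
  shows "convex (pos_set \<psi>)"
  unfolding convex_alt
proof (intro ballI allI impI)
  fix x y :: 'a and t :: real
  assume xy: "x \<in> pos_set \<psi>" "y \<in> pos_set \<psi>" and "0 \<le> t \<and> t \<le> 1"
  then consider "t = 0" | "t = 1" | "0 < t" "t < 1" by linarith
  then show "(1 - t) *\<^sub>R x + t *\<^sub>R y \<in> pos_set \<psi>"
    by cases (use xy alpha_concave_two_points(1)[OF assms] in auto)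
qed

text \<open>The transformed \<psi> is concave on the interior of the support, which is open and
  convex. Convex functions on open sets in finite dimension are continuous, and the continuity
  passes back through the transform.\<close>

lemma alpha_concave_isCont:
  fixes \<psi> :: "'a::euclidean_space \<Rightarrow> real"
  assumes m: "1 < CARD('m::finite)" and \<psi>: "alpha_concave TYPE('m) (ereal q) \<psi>"
    and x: "x \<in> interior (pos_set \<psi>)"
  shows "isCont \<psi> x"
proof -
  let ?U = "interior (pos_set \<psi>)"
  have pos: "0 < \<psi> y" if "y \<in> ?U" for y
    using that interior_subset[of "pos_set \<psi>"] by (auto simp: pos_set_def)
  have "convex_on ?U (\<lambda>y. - power_scale q (\<psi> y))"
  proof (rule convex_onI)
    fix t :: real and y z
    assume "0 < t" "t < 1" "y \<in> ?U" "z \<in> ?U"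
    then show "- power_scale q (\<psi> ((1 - t) *\<^sub>R y + t *\<^sub>R z))
        \<le> (1 - t) * - power_scale q (\<psi> y) + t * - power_scale q (\<psi> z)"
      using alpha_concave_two_points(2)[OF m \<psi>, of t y z] interior_subset[of "pos_set \<psi>"]
      by (simp add: subset_iff)
  qed (intro convex_interior convex_pos_set[OF m \<psi>])
  then have "continuous_on ?U (\<lambda>y. - power_scale q (\<psi> y))"
    by (intro convex_on_continuous) auto
  then have "continuous_on ?U (\<lambda>y. - (- power_scale q (\<psi> y)))"
    by (rule continuous_on_minus)
  then have "isCont (\<lambda>y. power_scale q (\<psi> y)) x"
    using x by (simp add: continuous_on_eq_continuous_at)
  then show ?thesis
    unfolding isCont_def
  proof (rule tendsto_of_power_scale)
    have "eventually (\<lambda>y. y \<in> ?U) (at x)"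
      using x by (intro eventually_at_in_open') auto
    then show "eventually (\<lambda>y. 0 < \<psi> y) (at x)"
      by eventually_elim (rule pos)
  qed (rule pos[OF x])
qed

text \<open>After the transform the mean is a finite linear combination, which treats q = 0 and q
  \<noteq> 0 alike.\<close>

lemma tendsto_power_mean:
  fixes a :: "'b \<Rightarrow> 'm::finite \<Rightarrow> real"
  assumes w: "weight lam" and a: "\<And>i. ((\<lambda>x. a x i) \<longlongrightarrow> l i) F" and l: "\<And>i. 0 < l i"
  shows "((\<lambda>x. power_mean (ereal q) lam (a x)) \<longlongrightarrow> power_mean (ereal q) lam l) F"
proof -
  have pos: "eventually (\<lambda>x. \<forall>i. 0 < a x i) F"
    using order_tendstoD(1)[OF a l] by (simp add: eventually_all_finite)
  have l0: "l i \<noteq> 0" for i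
    using l[of i] by simp
  have "((\<lambda>x. power_scale q (a x i)) \<longlongrightarrow> power_scale q (l i)) F" for i
    using l0[of i] a unfolding power_scale_def by (cases "q = 0") (auto intro!: tendsto_eq_intros)
  then have "((\<lambda>x. \<Sum>i\<in>UNIV. lam i * power_scale q (a x i)) \<longlongrightarrow> (\<Sum>i\<in>UNIV. lam i * power_scale q (l i))) F"
    by (intro tendsto_intros)
  moreover have "eventually (\<lambda>x. (\<Sum>i\<in>UNIV. lam i * power_scale q (a x i))
      = power_scale q (power_mean (ereal q) lam (a x))) F"
    using pos by eventually_elim (simp add: power_scale_power_mean[OF w])
  ultimately have "((\<lambda>x. power_scale q (power_mean (ereal q) lam (a x)))
      \<longlongrightarrow> power_scale q (power_mean (ereal q) lam l)) F"
    by (simp add: tendsto_cong power_scale_power_mean[OF w l])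
  then show ?thesis
  proof (rule tendsto_of_power_scale)
    show "eventually (\<lambda>x. 0 < power_mean (ereal q) lam (a x)) F"
      using pos by eventually_elim (simp add: power_mean_pos[OF w])
  qed (rule power_mean_pos[OF w l])
qed

section \<open>Measurability, essential infimum and scaling of the L1 norm\<close>

text \<open>A convex set differs from its open interior only by part of its frontier, which is a
  null set.\<close>

lemma convex_sets_lebesgue:
  fixes S :: "'a::euclidean_space set"
  assumes "convex S"
  shows "S \<in> sets lebesgue"
proof -
  have "negligible (S - interior S)"
    using closure_subset[of S]
    by (intro negligible_subset[OF negligible_convex_frontier[OF assms]]) (auto simp: frontier_def)
  then have "interior S \<union> (S - interior S) \<in> sets lebesgue"
    by (intro sets.Un) (auto simp: negligible_imp_sets)
  then show ?thesis
    using interior_subset[of S] by (simp add: Un_absorb1)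
qed

text \<open>A number c > l fails to be an almost-everywhere lower bound as soon as the set where F <
  c is not null; it then suffices to exhibit a non-null subset, such as a nonempty open set.\<close>

lemma ess_inf_lebesgue_on_eqI:
  fixes S :: "'a::euclidean_space set" and l :: ereal
  assumes S: "S \<in> sets lebesgue" and lower: "\<And>x. x \<in> S \<Longrightarrow> l \<le> F x"
    and upper: "\<And>c. l < c \<Longrightarrow> \<not> negligible {x \<in> S. F x < c}"
  shows "ess_inf (lebesgue_on S) F = l"
  unfolding ess_inf_def
proof (rule Sup_eqI)
  fix c assume "c \<in> {c. AE x in lebesgue_on S. c \<le> F x}"
  then have "AE x in lebesgue. x \<in> S \<longrightarrow> c \<le> F x"
    using S by (simp add: AE_restrict_space_iff)
  then have "negligible {x. \<not> (x \<in> S \<longrightarrow> c \<le> F x)}"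
    by (simp add: negligible_iff_null_sets completion.AE_iff_null_sets)
  moreover have "{x. \<not> (x \<in> S \<longrightarrow> c \<le> F x)} = {x \<in> S. F x < c}"
    by auto
  ultimately show "c \<le> l"
    using upper[of c] by (metis not_le)
next
  fix y assume "\<And>c. c \<in> {c. AE x in lebesgue_on S. c \<le> F x} \<Longrightarrow> c \<le> y"
  moreover have "AE x in lebesgue_on S. l \<le> F x"
    using lower by (intro AE_I2) simp
  ultimately show "l \<le> y"
    by simp
qed

text \<open>Substitution x = t + r y, whose Jacobian is r to the power of the dimension.\<close>

lemma L1_norm_affine:
  fixes f :: "'a::euclidean_space \<Rightarrow> real"
  assumes f: "f \<in> borel_measurable lebesgue" and r: "0 < r" and c: "0 \<le> c"
  shows "L1_norm (\<lambda>x. c * f ((x - t) /\<^sub>R r)) = c * r ^ DIM('a) * L1_norm f"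
proof -
  \<comment> \<open>A coordinatewise scaling with all factors equal is scalar multiplication; this
    brings the affine change of variables into the form used here.\<close>
  have affine: "(\<lambda>x. v + (\<Sum>j\<in>Basis. (s * (x \<bullet> j)) *\<^sub>R j)) = (\<lambda>x. v + s *\<^sub>R x)" for s and v :: 'a
    unfolding scaleR_scaleR[symmetric] scaleR_sum_right[symmetric] euclidean_representation ..
  have meas: "(\<lambda>x. v + s *\<^sub>R x) \<in> lebesgue \<rightarrow>\<^sub>M lebesgue" if "s \<noteq> 0" for s and v :: 'a
    using lebesgue_affine_measurable[of "\<lambda>_. s" v] that by (simp add: affine)
  let ?h = "\<lambda>x. \<bar>c * f ((x - t) /\<^sub>R r)\<bar>"
  have "(\<lambda>x. f (- (t /\<^sub>R r) + inverse r *\<^sub>R x)) \<in> borel_measurable lebesgue"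
    using r by (intro measurable_compose[OF meas f]) simp
  then have "(\<lambda>x. f ((x - t) /\<^sub>R r)) \<in> borel_measurable lebesgue"
    by (simp add: algebra_simps)
  then have h: "?h \<in> borel_measurable lebesgue"
    by measurable
  \<comment> \<open>Lebesgue measure as the rescaled image of itself: the density yields the
    Jacobian and the image measure yields the substitution.\<close>
  have leb: "(lebesgue :: 'a measure) = density (distr lebesgue lebesgue (\<lambda>x. t + r *\<^sub>R x)) (\<lambda>_. ennreal (r ^ DIM('a)))"
    using lebesgue_affine_euclidean[of "\<lambda>_. r" t] r by (simp add: affine)
  have "L1_norm (\<lambda>x. c * f ((x - t) /\<^sub>R r))
      = (\<integral>x. ?h x \<partial>density (distr lebesgue lebesgue (\<lambda>x. t + r *\<^sub>R x)) (\<lambda>_. ennreal (r ^ DIM('a))))"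
    unfolding L1_norm_def using leb by simp
  also have "\<dots> = (\<integral>x. r ^ DIM('a) *\<^sub>R ?h x \<partial>distr lebesgue lebesgue (\<lambda>x. t + r *\<^sub>R x))"
    using h r by (intro integral_density) auto
  also have "\<dots> = (\<integral>x. r ^ DIM('a) *\<^sub>R ?h (t + r *\<^sub>R x) \<partial>lebesgue)"
    using h r by (intro integral_distr meas) auto
  also have "\<dots> = c * r ^ DIM('a) * L1_norm f"
    using r c by (simp add: L1_norm_def abs_mult mult.assoc mult.left_commute)
  finally show ?thesis .
qed

section \<open>The ratio controlled by concavity\<close>

definition concavity_ratio ::
    "real \<Rightarrow> ('m::finite \<Rightarrow> real) \<Rightarrow> ('a::real_vector \<Rightarrow> real) \<Rightarrow> 'a ^ 'm \<Rightarrow> real" where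
  "concavity_ratio q lam \<psi> y = \<psi> (weighted_sum lam y) / power_mean (ereal q) lam (\<lambda>i. \<psi> (y $ i))"

lemma concavity_ratio_ge_1:
  fixes \<psi> :: "'a::real_vector \<Rightarrow> real" and y :: "'a ^ 'm::finite"
  assumes "alpha_concave TYPE('m) (ereal q) \<psi>" and "weight lam" and "\<And>i. y $ i \<in> pos_set \<psi>"
  shows "1 \<le> concavity_ratio q lam \<psi> y"
  using alpha_concave_weighted_sum[OF assms] by (simp add: concavity_ratio_def)

lemma weighted_sum_const:
  assumes "weight lam" and "\<And>i. y $ i = v"
  shows "weighted_sum lam y = v"
  using assms by (simp add: weighted_sum_def scaleR_sum_left[symmetric] weight_def)

text \<open>Numerator and denominator both equal \<psi> v > 0. This settles m = 1, where every tuple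
  is constant.\<close>

lemma concavity_ratio_const:
  assumes "weight lam" and "\<And>i. y $ i = v" and "v \<in> pos_set \<psi>"
  shows "concavity_ratio q lam \<psi> y = 1"
  using assms by (simp add: concavity_ratio_def weighted_sum_const power_mean_const pos_set_def)

text \<open>By continuity of \<psi> at v, numerator and denominator both tend to \<psi> v > 0. The
  family Y along a filter leaves room for the affine coordinates of the application.\<close>

lemma tendsto_concavity_ratio_const:
  fixes \<psi> :: "'a::euclidean_space \<Rightarrow> real" and Y :: "'b \<Rightarrow> 'a ^ 'm::finite"
  assumes m: "1 < CARD('m)" and \<psi>: "alpha_concave TYPE('m) (ereal q) \<psi>" and w: "weight lam"
    and v: "v \<in> interior (pos_set \<psi>)" and Y: "\<And>i. ((\<lambda>x. Y x $ i) \<longlongrightarrow> v) F"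
  shows "((\<lambda>x. concavity_ratio q lam \<psi> (Y x)) \<longlongrightarrow> 1) F"
proof -
  have pos: "0 < \<psi> v"
    using v interior_subset[of "pos_set \<psi>"] by (auto simp: pos_set_def)
  have cont: "isCont \<psi> v"
    by (rule alpha_concave_isCont[OF m \<psi> v])
  have "((\<lambda>x. weighted_sum lam (Y x)) \<longlongrightarrow> (\<Sum>i\<in>UNIV. lam i *\<^sub>R v)) F"
    unfolding weighted_sum_def by (intro tendsto_intros Y)
  then have "((\<lambda>x. weighted_sum lam (Y x)) \<longlongrightarrow> v) F"
    using w by (simp add: scaleR_sum_left[symmetric] weight_def)
  then have "((\<lambda>x. \<psi> (weighted_sum lam (Y x))) \<longlongrightarrow> \<psi> v) F"
    by (rule isCont_tendsto_compose[OF cont])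
  moreover have "((\<lambda>x. power_mean (ereal q) lam (\<lambda>i. \<psi> (Y x $ i))) \<longlongrightarrow> power_mean (ereal q) lam (\<lambda>i. \<psi> v)) F"
    using pos by (intro tendsto_power_mean[OF w] isCont_tendsto_compose[OF cont] Y)
  ultimately have "((\<lambda>x. concavity_ratio q lam \<psi> (Y x)) \<longlongrightarrow> \<psi> v / \<psi> v) F"
    using pos unfolding concavity_ratio_def by (intro tendsto_intros) (simp_all add: power_mean_const[OF w])
  then show ?thesis
    using pos by simp
qed

section \<open>The essential infimum in rescaled coordinates\<close>

text \<open>For m = 1 concavity gives no convexity of the support, so the product set is treated as
  the image of A under an affine bijection. The two spaces have equal dimension, and differentiable
  maps between them preserve Lebesgue measurable sets and null sets.\<close>

lemma singleton_index_preimage: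
  fixes A :: "'a::euclidean_space set" and \<theta> :: "'a ^ 'm::finite"
  assumes m: "CARD('m) = 1" and r: "\<And>i. 0 < r i"
    and A: "A \<in> sets lebesgue" "\<not> negligible A"
  defines "S \<equiv> {x. \<forall>i. (x $ i - \<theta> $ i) /\<^sub>R r i \<in> A}"
  shows "S \<in> sets lebesgue" and "\<not> negligible S"
proof -
  obtain i\<^sub>0 :: 'm where i\<^sub>0: "UNIV = {i\<^sub>0}"
    using m by (auto simp: card_1_singleton_iff)
  have eq: "i = i\<^sub>0" for i
    using i\<^sub>0 by auto
  have dim: "DIM('a ^ 'm) = DIM('a)"
    using m by simp
  have r0: "r i\<^sub>0 \<noteq> 0"
    using r[of i\<^sub>0] by simp
  define T :: "'a \<Rightarrow> 'a ^ 'm" where "T v = (\<chi> i. \<theta> $ i\<^sub>0 + r i\<^sub>0 *\<^sub>R v)" for v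
  have T: "(T v $ i - \<theta> $ i) /\<^sub>R r i = v" for v i
    using r0 eq[of i] by (simp add: T_def)
  have "S = T ` A"
  proof (intro equalityI subsetI)
    fix x assume "x \<in> S"
    then have "(x $ i\<^sub>0 - \<theta> $ i\<^sub>0) /\<^sub>R r i\<^sub>0 \<in> A"
      by (simp add: S_def)
    moreover have "x = T ((x $ i\<^sub>0 - \<theta> $ i\<^sub>0) /\<^sub>R r i\<^sub>0)"
      using r0 arg_cong[OF eq, of "\<lambda>j. x $ j"] by (simp add: T_def vec_eq_iff)
    ultimately show "x \<in> T ` A" by blast
  next
    fix x assume "x \<in> T ` A"
    then obtain v where "v \<in> A" "x = T v"
      by blast
    then show "x \<in> S"
      unfolding S_def mem_Collect_eq by (simp only: T simp_thms)
  qed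
  moreover have "T differentiable_on A"
  proof -
    have "bounded_linear (\<lambda>v. (\<chi> i. v) :: 'a ^ 'm)"
      by (intro linear_conv_bounded_linear[THEN iffD1] linearI) (simp_all add: vec_eq_iff)
    then have "(\<lambda>v. (\<chi> i. v) :: 'a ^ 'm) differentiable_on X" for X
      by (rule bounded_linear_imp_differentiable_on)
    then have "(\<lambda>v. (\<chi> i. \<theta> $ i\<^sub>0) + r i\<^sub>0 *\<^sub>R ((\<chi> i. v) :: 'a ^ 'm)) differentiable_on A"
      by (intro differentiable_on_add differentiable_on_scaleR differentiable_on_const)
    moreover have "T = (\<lambda>v. (\<chi> i. \<theta> $ i\<^sub>0) + r i\<^sub>0 *\<^sub>R ((\<chi> i. v) :: 'a ^ 'm))"
      by (simp add: fun_eq_iff vec_eq_iff T_def)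
    ultimately show ?thesis
      by simp
  qed
  ultimately show "S \<in> sets lebesgue"
    using A(1) dim by (simp add: differentiable_image_in_sets_lebesgue)
  show "\<not> negligible S"
  \<comment> \<open>The inverse affine map carries S back onto a set containing A, so a null S would
    make A null.\<close>
  proof
    assume "negligible S"
    moreover have "(\<lambda>x. (x $ i\<^sub>0 - \<theta> $ i\<^sub>0) /\<^sub>R r i\<^sub>0) differentiable_on S"
      by (intro differentiable_on_scaleR differentiable_on_diff differentiable_on_const
          bounded_linear_imp_differentiable_on bounded_linear_vec_nth)
    ultimately have "negligible ((\<lambda>x. (x $ i\<^sub>0 - \<theta> $ i\<^sub>0) /\<^sub>R r i\<^sub>0) ` S)"
      using dim by (intro negligible_differentiable_image_negligible) auto
    moreover have "A \<subseteq> (\<lambda>x. (x $ i\<^sub>0 - \<theta> $ i\<^sub>0) /\<^sub>R r i\<^sub>0) ` S"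
    proof
      fix v assume "v \<in> A"
      then have "T v \<in> S"
        using \<open>S = T ` A\<close> by blast
      moreover have "v = (T v $ i\<^sub>0 - \<theta> $ i\<^sub>0) /\<^sub>R r i\<^sub>0"
        by (rule T[symmetric])
      ultimately show "v \<in> (\<lambda>x. (x $ i\<^sub>0 - \<theta> $ i\<^sub>0) /\<^sub>R r i\<^sub>0) ` S"
        by blast
    qed
    ultimately show False
      using A(2) negligible_subset by blast
  qed
qed

lemma convex_affine_preimage:
  fixes A :: "'a::real_vector set" and \<theta> :: "'a ^ 'm::finite"
  assumes "convex A"
  shows "convex {x. \<forall>i. (x $ i - \<theta> $ i) /\<^sub>R r i \<in> A}"
proof (rule convexI)
  fix x y :: "'a ^ 'm" and u v :: real
  assume x: "x \<in> {x. \<forall>i. (x $ i - \<theta> $ i) /\<^sub>R r i \<in> A}" and y: "y \<in> {x. \<forall>i. (x $ i - \<theta> $ i) /\<^sub>R r i \<in> A}"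
    and uv: "0 \<le> u" "0 \<le> v" "u + v = 1"
  have "((u *\<^sub>R x + v *\<^sub>R y) $ i - \<theta> $ i) /\<^sub>R r i
      = u *\<^sub>R ((x $ i - \<theta> $ i) /\<^sub>R r i) + v *\<^sub>R ((y $ i - \<theta> $ i) /\<^sub>R r i)" for i
  proof -
    \<comment> \<open>The translation is distributed over both terms by writing \<theta>_i as (u +
      v) \<theta>_i.\<close>
    have "(u *\<^sub>R x + v *\<^sub>R y) $ i - \<theta> $ i = u *\<^sub>R x $ i + v *\<^sub>R y $ i - (u + v) *\<^sub>R \<theta> $ i"
      using uv by simp
    also have "\<dots> = u *\<^sub>R (x $ i - \<theta> $ i) + v *\<^sub>R (y $ i - \<theta> $ i)"
      by (simp add: algebra_simps)
    finally show ?thesis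
      by (simp add: scaleR_add_right mult.commute)
  qed
  then show "u *\<^sub>R x + v *\<^sub>R y \<in> {x. \<forall>i. (x $ i - \<theta> $ i) /\<^sub>R r i \<in> A}"
    using x y uv by (intro CollectI allI) (simp only: mem_Collect_eq convexD[OF assms])
qed

text \<open>The bound from below is pointwise. Its sharpness needs a non-null set where F is close
  to k: all of S when m = 1, a neighbourhood of a diagonal point otherwise. The form of F is
  prescribed only on S, where all \<psi> values in the mean are positive.\<close>

lemma ess_inf_concavity_ratio:
  fixes \<psi> :: "'a::euclidean_space \<Rightarrow> real" and \<theta> :: "'a ^ 'm::finite"
  assumes \<psi>: "alpha_concave TYPE('m) (ereal q) \<psi>" and w: "weight lam" and r: "\<And>i. 0 < r i"
    and A: "pos_set \<psi> \<in> sets lebesgue" "\<not> negligible (pos_set \<psi>)" and k: "0 \<le> k"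
    and S: "S = {x. \<forall>i. (x $ i - \<theta> $ i) /\<^sub>R r i \<in> pos_set \<psi>}"
    and F: "\<And>x. x \<in> S \<Longrightarrow> F x = ereal (k * concavity_ratio q lam \<psi> (\<chi> i. (x $ i - \<theta> $ i) /\<^sub>R r i))"
  shows "ess_inf (lebesgue_on S) F = ereal k"
proof -
  let ?Y = "\<lambda>x. (\<chi> i. (x $ i - \<theta> $ i) /\<^sub>R r i)"
  let ?G = "\<lambda>x. concavity_ratio q lam \<psi> (?Y x)"
  have lower: "ereal k \<le> F x" if "x \<in> S" for x
    using that concavity_ratio_ge_1[OF \<psi> w, of "?Y x"] mult_left_mono[OF _ k, of 1 "?G x"]
    by (simp add: F S)
  show ?thesis
  proof (cases "CARD('m) = 1")
    case True
    obtain i\<^sub>0 :: 'm where "UNIV = {i\<^sub>0}"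
      using True by (auto simp: card_1_singleton_iff)
    then have i\<^sub>0: "i = i\<^sub>0" for i
      by auto
    have "F x = ereal k" if "x \<in> S" for x
    proof -
      have "?Y x $ i = (x $ i\<^sub>0 - \<theta> $ i\<^sub>0) /\<^sub>R r i\<^sub>0" for i
        using i\<^sub>0[of i] by simp
      then have "?G x = 1"
        using that by (intro concavity_ratio_const[OF w]) (auto simp: S)
      then show ?thesis
        using that by (simp add: F)
    qed
    then have "{x \<in> S. F x < c} = S" if "ereal k < c" for c
      using that by auto
    then show ?thesis
      using singleton_index_preimage[OF True r A, where \<theta> = \<theta>] lower
      by (intro ess_inf_lebesgue_on_eqI) (simp_all add: S)
  next
    case False
    then have m: "1 < CARD('m)"
      using zero_less_card_finite[where 'a = 'm] by linarith
    note cvx = convex_pos_set[OF m \<psi>]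
    \<comment> \<open>A convex set that is not null has interior points.\<close>
    obtain v where v: "v \<in> interior (pos_set \<psi>)"
      using A(2) negligible_convex_interior[OF cvx] by auto
    \<comment> \<open>The point whose rescaled coordinates all equal v. Limits are taken along
      \<open>nhds\<close>, so the open set found below contains this point and is nonempty.\<close>
    define x\<^sub>0 where "x\<^sub>0 = (\<chi> i. \<theta> $ i + r i *\<^sub>R v)"
    have lim: "((\<lambda>x. ?Y x $ i) \<longlongrightarrow> v) (nhds x\<^sub>0)" for i
    proof -
      have "((\<lambda>x. ?Y x $ i) \<longlongrightarrow> (x\<^sub>0 $ i - \<theta> $ i) /\<^sub>R r i) (nhds x\<^sub>0)"
        by (simp only: vec_lambda_beta) (intro tendsto_intros filterlim_ident)
      then show ?thesis
        using r[of i] by (simp add: x\<^sub>0_def)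
    qed
    have "eventually (\<lambda>x. \<forall>i. ?Y x $ i \<in> interior (pos_set \<psi>)) (nhds x\<^sub>0)"
      using topological_tendstoD[OF lim _ v] by (intro eventually_all_finite) auto
    then have in_S: "eventually (\<lambda>x. x \<in> S) (nhds x\<^sub>0)"
      by eventually_elim (use interior_subset[of "pos_set \<psi>"] in \<open>auto simp: S\<close>)
    have "((\<lambda>x. k * ?G x) \<longlongrightarrow> k * 1) (nhds x\<^sub>0)"
      by (intro tendsto_intros tendsto_concavity_ratio_const[OF m \<psi> w v] lim)
    then have lim_F: "((\<lambda>x. ereal (k * ?G x)) \<longlongrightarrow> ereal k) (nhds x\<^sub>0)"
      by simp
    show ?thesis
    proof (rule ess_inf_lebesgue_on_eqI)
      show "S \<in> sets lebesgue"
        unfolding S by (intro convex_sets_lebesgue convex_affine_preimage cvx)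
      fix c assume c: "ereal k < c"
      have "eventually (\<lambda>x. x \<in> {x \<in> S. F x < c}) (nhds x\<^sub>0)"
        using in_S order_tendstoD(2)[OF lim_F c] by eventually_elim (simp add: F)
      then obtain U where U: "open U" "x\<^sub>0 \<in> U" "U \<subseteq> {x \<in> S. F x < c}"
        unfolding eventually_nhds by auto
      then show "\<not> negligible {x \<in> S. F x < c}"
        using open_not_negligible[of U] negligible_subset by blast
    qed (rule lower)
  qed
qed

text \<open>The factor \<gamma>_i^p of the tilted weight cancels the rescaling of the i-th
  coordinate, leaving lam_i over the common denominator.\<close>

lemma weighted_sum_rescale:
  fixes x \<theta> :: "'a::real_vector ^ 'm::finite"
  assumes "\<And>i. 0 < \<gamma> i"
  shows "(weighted_sum lam x - weighted_sum lam \<theta>) /\<^sub>R (power_mean (ereal p) lam \<gamma> powr p)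
    = weighted_sum (tilted_weight p lam \<gamma>) (\<chi> i. (x $ i - \<theta> $ i) /\<^sub>R (\<gamma> i powr p))"
proof -
  let ?M = "power_mean (ereal p) lam \<gamma> powr p"
  have *: "tilted_weight p lam \<gamma> i *\<^sub>R ((x $ i - \<theta> $ i) /\<^sub>R (\<gamma> i powr p)) = (lam i *\<^sub>R (x $ i - \<theta> $ i)) /\<^sub>R ?M" for i
    using assms[of i] by (simp add: tilted_weight_def divide_inverse_commute)
  show ?thesis
    unfolding weighted_sum_def vec_lambda_beta * by (simp add: sum_subtractf scaleR_diff_right scaleR_sum_right)
qed

theorem proposition6p4:
  fixes lam \<gamma> \<kappa> :: "'m::finite \<Rightarrow> real"
    and p \<gamma>\<^sub>0 \<omega> :: real
    and \<theta> :: "real ^ 'd::finite ^ 'm"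
    and \<psi> :: "real ^ 'd \<Rightarrow> real"
    and f g :: "'m \<Rightarrow> real ^ 'd \<Rightarrow> real"
    and S :: "(real ^ 'd ^ 'm) set"
    and K :: ereal
  assumes "weight lam"
    and "p \<le> 1 / real CARD('d)"
    and "\<And>i. 0 < \<gamma> i"
    and "\<gamma>\<^sub>0 = power_mean (ereal p) lam \<gamma>"
    and "\<And>i. 0 < \<kappa> i"
    and "0 \<le> \<omega>"
    and "\<And>x. 0 \<le> \<psi> x"
    and "integrable lebesgue \<psi>"
    and "alpha_concave TYPE('m) (ereal (- p)) \<psi>"
    and "0 < L1_norm \<psi>"
    and "\<And>i x. f i x = \<kappa> i * \<psi> ((x - \<theta> $ i) /\<^sub>R (\<gamma> i powr p))"
    and "\<And>i x. g i x = \<omega> * \<kappa> i * \<gamma> i * \<psi> ((x - weighted_sum lam \<theta>) /\<^sub>R (\<gamma>\<^sub>0 powr p))"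
    and "S = {x. \<forall>i. x $ i \<in> pos_set (f i)}"
    and "K = ess_inf (lebesgue_on S)
               (\<lambda>x. ereal (power_mean (ereal p) lam (\<lambda>i. g i (weighted_sum lam x) / f i (x $ i))))"
  shows "K = ereal (power_mean (power_transform CARD('d) (ereal p)) lam
                      (\<lambda>i. L1_norm (g i) / L1_norm (f i)))
       \<and> power_mean (power_transform CARD('d) (ereal p)) lam
            (\<lambda>i. L1_norm (g i) / L1_norm (f i)) = \<omega> * \<gamma>\<^sub>0"
proof -
  note w = assms(1) and \<gamma> = assms(3) and \<gamma>\<^sub>0 = assms(4) and \<kappa> = assms(5) and \<omega> = assms(6)
    and f = assms(11) and g = assms(12)
  let ?d = "real CARD('d)" and ?lam = "tilted_weight p lam \<gamma>"
  have [measurable]: "\<psi> \<in> borel_measurable lebesgue"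
    using assms(8) by (rule borel_measurable_integrable)
  have \<gamma>\<^sub>0_pos: "0 < \<gamma>\<^sub>0"
    unfolding \<gamma>\<^sub>0 by (rule power_mean_pos[OF w \<gamma>])
  have powr_pos: "0 < \<gamma> i powr p" for i
    using \<gamma>[of i] by simp
  have w': "weight ?lam"
    by (rule weight_tilted_weight[OF w \<gamma>])

  have pos_set_meas: "pos_set \<psi> \<in> sets lebesgue"
  proof -
    have "{x \<in> space lebesgue. 0 < \<psi> x} \<in> sets lebesgue"
      by measurable
    then show ?thesis
      by (simp add: pos_set_def)
  qed
  \<comment> \<open>Otherwise \<psi> would vanish almost everywhere and have norm 0.\<close>
  have pos_set_large: "\<not> negligible (pos_set \<psi>)"
  proof
    assume "negligible (pos_set \<psi>)"
    then have "AE x in lebesgue. x \<notin> pos_set \<psi>"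
      by (simp add: negligible_iff_null_sets AE_not_in)
    then have "AE x in lebesgue. \<bar>\<psi> x\<bar> = 0"
    proof eventually_elim
      case (elim x)
      then show ?case using assms(7)[of x] by (simp add: pos_set_def)
    qed
    then have "L1_norm \<psi> = 0"
      unfolding L1_norm_def by (rule integral_eq_zero_AE)
    then show False
      using assms(10) by simp
  qed

  have norm_f: "L1_norm (f i) = \<kappa> i * (\<gamma> i powr p) ^ CARD('d) * L1_norm \<psi>" for i
    using L1_norm_affine[of \<psi> "\<gamma> i powr p" "\<kappa> i" "\<theta> $ i"] powr_pos[of i] \<kappa>[of i]
    by (simp add: f[abs_def] less_imp_le)
  have norm_g: "L1_norm (g i) = \<omega> * \<kappa> i * \<gamma> i * (\<gamma>\<^sub>0 powr p) ^ CARD('d) * L1_norm \<psi>" for i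
    using L1_norm_affine[of \<psi> "\<gamma>\<^sub>0 powr p" "\<omega> * \<kappa> i * \<gamma> i" "weighted_sum lam \<theta>"] \<gamma>\<^sub>0_pos \<kappa>[of i] \<gamma>[of i] \<omega>
    by (simp add: g[abs_def] less_imp_le)
  \<comment> \<open>The factors \<kappa>_i and the norm of \<psi> cancel. What remains is a constant
    times \<gamma>_i^(1 - d p), the form to which the power transform applies.\<close>
  have "L1_norm (g i) / L1_norm (f i) = \<omega> * \<gamma>\<^sub>0 powr (?d * p) * \<gamma> i powr (1 - ?d * p)" for i
  proof -
    have "(\<gamma> i powr p) ^ CARD('d) = \<gamma> i powr (?d * p)" "(\<gamma>\<^sub>0 powr p) ^ CARD('d) = \<gamma>\<^sub>0 powr (?d * p)"
      using \<gamma>[of i] \<gamma>\<^sub>0_pos by (simp_all add: powr_realpow[symmetric] powr_powr mult.commute)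
    then show ?thesis
      using \<gamma>[of i] \<kappa>[of i] assms(10) by (simp add: norm_f norm_g powr_diff)
  qed
  then have "power_mean (power_transform CARD('d) (ereal p)) lam (\<lambda>i. L1_norm (g i) / L1_norm (f i))
      = \<omega> * \<gamma>\<^sub>0 powr (?d * p) * \<gamma>\<^sub>0 powr (1 - ?d * p)"
    using power_mean_power_transform[OF w \<gamma>, of "CARD('d)" p "\<omega> * \<gamma>\<^sub>0 powr (?d * p)"] assms(2) \<omega>
    by (simp add: \<gamma>\<^sub>0)
  also have "\<dots> = \<omega> * \<gamma>\<^sub>0"
    using \<gamma>\<^sub>0_pos by (simp add: mult.assoc powr_add[symmetric])
  finally have mean: "power_mean (power_transform CARD('d) (ereal p)) lam
      (\<lambda>i. L1_norm (g i) / L1_norm (f i)) = \<omega> * \<gamma>\<^sub>0" .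

  \<comment> \<open>Positive factors do not change supports, so S is a product of affine copies of
    the support of \<psi>.\<close>
  have "0 < \<kappa> i * s \<longleftrightarrow> 0 < s" for i s
    using \<kappa>[of i] by (simp add: zero_less_mult_iff)
  then have S: "S = {x. \<forall>i. (x $ i - \<theta> $ i) /\<^sub>R (\<gamma> i powr p) \<in> pos_set \<psi>}"
    by (simp add: assms(13) f pos_set_def)
  have "K = ereal (\<omega> * \<gamma>\<^sub>0)"
    unfolding assms(14)
  proof (rule ess_inf_concavity_ratio[OF assms(9) w' powr_pos pos_set_meas pos_set_large _ S])
    show "0 \<le> \<omega> * \<gamma>\<^sub>0"
      using \<omega> \<gamma>\<^sub>0_pos by simp
  next
    fix x assume "x \<in> S"
    let ?y = "\<chi> i. (x $ i - \<theta> $ i) /\<^sub>R (\<gamma> i powr p)"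
    let ?c = "\<psi> (weighted_sum ?lam ?y)"
    have y: "0 < \<psi> (?y $ i)" for i
      using \<open>x \<in> S\<close> by (simp add: S pos_set_def)
    \<comment> \<open>Again \<kappa>_i cancels, and the numerator value of \<psi> is common to all
      i. Homogeneity extracts it, and the quotient identity then turns the remaining mean of
      \<gamma>_i / \<psi>(y_i) into \<open>\<gamma>\<^sub>0\<close> over the tilted mean of exponent
      -p.\<close>
    have "g i (weighted_sum lam x) / f i (x $ i) = (\<omega> * ?c) * (\<gamma> i / \<psi> (?y $ i))" for i
      using \<kappa>[of i] weighted_sum_rescale[where lam = lam and x = x and \<theta> = \<theta> and p = p, OF \<gamma>] by (simp add: f g \<gamma>\<^sub>0)
    then have "power_mean (ereal p) lam (\<lambda>i. g i (weighted_sum lam x) / f i (x $ i))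
        = \<omega> * ?c * power_mean (ereal p) lam (\<lambda>i. \<gamma> i / \<psi> (?y $ i))"
      using y \<gamma> \<omega> assms(7) by (simp only: power_mean_scale[OF w] mult_nonneg_nonneg divide_pos_pos)
    also have "\<dots> = \<omega> * \<gamma>\<^sub>0 * concavity_ratio (- p) ?lam \<psi> ?y"
      using power_mean_divide[OF w \<gamma> y, of p] by (simp add: concavity_ratio_def \<gamma>\<^sub>0)
    finally show "ereal (power_mean (ereal p) lam (\<lambda>i. g i (weighted_sum lam x) / f i (x $ i)))
        = ereal (\<omega> * \<gamma>\<^sub>0 * concavity_ratio (- p) ?lam \<psi> ?y)"
      by simp
  qed
  with mean show ?thesis
    by simp
qed

end
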